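(* For $k\in\mathbb{N}_0$ and $a>0$, \[ \int_0^\infty \frac{x^2\ln x\,dx}{(x-1)(x+a)^{k+3}} = \frac{\pi^2+\ln^2 a}{2(a+1)^{k+3}} + \frac{1}{(k+1)(k+2)(a+1)^{k+1}}\left(\frac{a+3+2k}{a+1}\ln a + 1 + \frac1a\sum_{j=0}^{k-1}\frac{(1+1/a)^j}{j+1}\left(\frac{(k-j)(k+1-j)}{a+1}(H_j-\ln a) - a - 1 - 2(k-j)\right)\right). \]
   Context: $H_n=\sum_{i=1}^n \frac1i$ denotes the $n$-th harmonic number, with $H_0=0$. Empty sums are zero. *)

theory Defs
  imports "HOL-Analysis.Analysis"
begin

end

theory Submission imports Defs "HOL-Real_Asymp.Real_Asymp" begin

text \<open>
  Since \<open>x\<^sup>2 / (x - 1) = 1 / (x - 1) + x + 1\<close>, the integral splits into integrals of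
  \<open>ln x / (x + a)\<^sup>m\<close>, evaluated by integration by parts, and one of
  \<open>ln x / ((x - 1) (x + a)\<^sup>m)\<close>, which partial fractions reduce to \<open>m = 1\<close>.
  Let \<open>E\<close> be the antiderivative of \<open>ln x / (x - 1)\<close> with \<open>E 1 = 0\<close> (a dilogarithm).
  Then \<open>E x - ln x ln (1 + x / a) + E (1 + x / a)\<close> is an antiderivative for
  \<open>(a + 1) ln x / ((x - 1) (x + a))\<close>, and its limits at \<open>0\<close> and \<open>\<infinity>\<close> follow from
  \<open>E 0 = - \<pi>\<^sup>2 / 6\<close> and the inversion formula \<open>E x + E (1 / x) = ln\<^sup>2 x / 2\<close>.
  The resulting sum is brought into the stated form by expanding \<open>(k - j) (k + 1 - j)\<close> in
  powers of \<open>j + 1\<close> and summing by parts.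
\<close>

section \<open>Integrals over the positive reals through antiderivatives\<close>

text \<open>Convergence is required only at the level of antiderivatives, so that the sign changes of
  \<open>ln\<close> do no harm; the final integrand is nonnegative, which makes it integrable.\<close>

definition has_newton_integral :: "(real \<Rightarrow> real) \<Rightarrow> real \<Rightarrow> bool" where
  "has_newton_integral f v \<longleftrightarrow> (\<exists>F l u. (\<forall>x>0. (F has_real_derivative f x) (at x)) \<and>
     (F \<longlongrightarrow> l) (at_right 0) \<and> (F \<longlongrightarrow> u) at_top \<and> v = u - l)"

lemma has_newton_integralI:
  assumes "\<And>x. x > 0 \<Longrightarrow> (F has_real_derivative f x) (at x)"
    and "(F \<longlongrightarrow> l) (at_right 0)" "(F \<longlongrightarrow> u) at_top" "v = u - l"
  shows "has_newton_integral f v"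
  using assms unfolding has_newton_integral_def by blast

lemma has_newton_integral_add:
  assumes "has_newton_integral f v" "has_newton_integral g w"
  shows "has_newton_integral (\<lambda>x. f x + g x) (v + w)"
proof -
  obtain F l u where F: "\<And>x. x > 0 \<Longrightarrow> (F has_real_derivative f x) (at x)"
    "(F \<longlongrightarrow> l) (at_right 0)" "(F \<longlongrightarrow> u) at_top" "v = u - l"
    using assms(1) unfolding has_newton_integral_def by blast
  obtain G l' u' where G: "\<And>x. x > 0 \<Longrightarrow> (G has_real_derivative g x) (at x)"
    "(G \<longlongrightarrow> l') (at_right 0)" "(G \<longlongrightarrow> u') at_top" "w = u' - l'"
    using assms(2) unfolding has_newton_integral_def by blast
  show ?thesis
    by (rule has_newton_integralI [of "\<lambda>x. F x + G x" _ "l + l'" "u + u'"])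
       (use F G in \<open>auto intro!: DERIV_add tendsto_add\<close>)
qed

lemma has_newton_integral_cmult:
  assumes "has_newton_integral f v"
  shows "has_newton_integral (\<lambda>x. c * f x) (c * v)"
proof -
  obtain F l u where F: "\<And>x. x > 0 \<Longrightarrow> (F has_real_derivative f x) (at x)"
    "(F \<longlongrightarrow> l) (at_right 0)" "(F \<longlongrightarrow> u) at_top" "v = u - l"
    using assms(1) unfolding has_newton_integral_def by blast
  show ?thesis
    by (rule has_newton_integralI [of "\<lambda>x. c * F x" _ "c * l" "c * u"])
       (use F in \<open>auto intro!: DERIV_cmult tendsto_mult_left simp: algebra_simps\<close>)
qed

lemma has_newton_integral_cong:
  assumes "has_newton_integral f v" "\<And>x. x > 0 \<Longrightarrow> f x = g x" "v = w"
  shows "has_newton_integral g w"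
  using assms unfolding has_newton_integral_def by metis

text \<open>Nonnegativity turns convergence of the antiderivative at both ends into absolute
  integrability, by the fundamental theorem for continuous nonnegative integrands. The Lebesgue
  integral is then read as a gauge integral.\<close>

lemma has_integral_if_has_newton_integral:
  assumes f: "has_newton_integral f v"
    and cont: "\<And>x. x > 0 \<Longrightarrow> isCont f x" and nonneg: "\<And>x. x > 0 \<Longrightarrow> f x \<ge> 0"
  shows "(f has_integral v) {0<..}"
proof -
  obtain F l u where F: "\<And>x. x > 0 \<Longrightarrow> (F has_real_derivative f x) (at x)"
    "(F \<longlongrightarrow> l) (at_right 0)" "(F \<longlongrightarrow> u) at_top" "v = u - l"
    using f unfolding has_newton_integral_def by blast
  \<comment> \<open>The fundamental theorem used below takes its end points in the extended reals,
    so both limits of \<open>F\<close> are transported along \<open>real_of_ereal\<close>.\<close>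
  have l: "((F \<circ> real_of_ereal) \<longlongrightarrow> l) (at_right 0)"
    using F(2) by (simp add: zero_ereal_def ereal_tendsto_simps1)
  have u: "((F \<circ> real_of_ereal) \<longlongrightarrow> u) (at_left \<infinity>)"
    using F(3) by (simp add: ereal_tendsto_simps1)
  have *: "einterval 0 \<infinity> = {0<..}" by (auto simp: einterval_def)
  have "set_integrable lborel (einterval 0 \<infinity>) f" "(LBINT x=0..\<infinity>. f x) = u - l"
    by (rule interval_integral_FTC_nonneg [OF _ _ _ _ l u]; use F(1) cont nonneg in auto)+
  then show ?thesis
    using set_borel_integral_eq_integral [of "{0<..}" f] F(4)
    by (simp add: * interval_lebesgue_integral_def has_integral_iff)
qed

section \<open>The quotient of ln x and x - 1, and its dilogarithm antiderivative\<close>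

text \<open>The value 1 fills the removable singularity, which makes the function continuous on the
  positive reals; plain division would give 0 at \<open>x = 1\<close>.\<close>

definition ln_quot :: "real \<Rightarrow> real" where
  "ln_quot x = (if x = 1 then 1 else ln x / (x - 1))"

lemma ln_quot_mult: "x > 0 \<Longrightarrow> (x - 1) * ln_quot x = ln x"
  by (simp add: ln_quot_def)

lemma ln_quot_nonneg: "x > 0 \<Longrightarrow> ln_quot x \<ge> 0"
  by (cases "x > 1") (auto simp: ln_quot_def divide_nonpos_nonpos)

lemma isCont_ln_quot:
  assumes "x > 0"
  shows "isCont ln_quot x"
proof (cases "x = 1")
  case True
  \<comment> \<open>The difference quotient of \<open>ln\<close> at 1 is
    \<open>ln y / (y - 1)\<close>, so its limit is this derivative.\<close>
  have "(ln has_real_derivative 1) (at 1)"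
    by (auto intro!: derivative_eq_intros)
  then have "((\<lambda>y::real. ln y / (y - 1)) \<longlongrightarrow> 1) (at 1)"
    by (simp add: has_field_derivative_iff)
  then have "(ln_quot \<longlongrightarrow> 1) (at 1)"
    by (rule Lim_transform_eventually) (auto simp: eventually_at_filter ln_quot_def)
  then show ?thesis by (simp add: True isCont_def ln_quot_def)
next
  case False
  have "isCont (\<lambda>y. ln y / (y - 1)) x"
    using False assms by (intro continuous_intros) auto
  moreover have "\<forall>\<^sub>F y in nhds x. ln_quot y = ln y / (y - 1)"
    using t1_space_nhds [OF False] by eventually_elim (simp add: ln_quot_def)
  ultimately show ?thesis by (simp cong: isCont_cong)
qed

text \<open>The series is the dilogarithm; its term at \<open>n = 0\<close> vanishes because
  \<open>1 / 0 = 0\<close>. Termwise differentiation leaves the terms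
  \<open>s ^ n / (n + 1)\<close>, whose sum is \<open>- ln (1 - s) / s\<close>, continued by 1 at
  \<open>s = 0\<close>.\<close>

lemma dilog_series_derivative:
  assumes "\<bar>s\<bar> < 1"
  shows "((\<lambda>s. \<Sum>n. 1 / (real n)\<^sup>2 * s ^ n) has_real_derivative ln_quot (1 - s)) (at s)"
proof -
  have "summable (\<lambda>n. 1 / (real n)\<^sup>2 * 1 ^ n)"
    using inverse_power_summable [of 2, where 'a = real] by (simp add: inverse_eq_divide)
  from termdiffs_strong [OF this, of s] assms
  have "((\<lambda>s. \<Sum>n. 1 / (real n)\<^sup>2 * s ^ n) has_real_derivative
      (\<Sum>n. diffs (\<lambda>n. 1 / (real n)\<^sup>2) n * s ^ n)) (at s)" by simp
  also have "(\<lambda>n. diffs (\<lambda>n. 1 / (real n)\<^sup>2) n * s ^ n) = (\<lambda>n. s ^ n / (real n + 1))"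
    by (auto simp: diffs_def power2_eq_square add_ac)
  also have "(\<Sum>n. s ^ n / (real n + 1)) = ln_quot (1 - s)"
  \<comment> \<open>The logarithm series yields the sum only after division by \<open>s\<close>, so
    \<open>s = 0\<close> is treated separately.\<close>
  proof (cases "s = 0")
    case True
    have "(\<lambda>n. s ^ n / (real n + 1)) = (\<lambda>n. if n = 0 then 1 else 0)"
      using True by auto
    then have "(\<lambda>n. s ^ n / (real n + 1)) sums 1"
      using sums_single [of 0 "\<lambda>_. 1 :: real"] by (simp only:)
    then show ?thesis using True by (simp add: ln_quot_def sums_iff)
  next
    case False
    have summ: "summable (\<lambda>n. s ^ n / (real n + 1))"
    proof (rule summable_comparison_test')
      show "summable (\<lambda>n. \<bar>s\<bar> ^ n)" using assms by (simp add: summable_geometric)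
      show "norm (s ^ n / (real n + 1)) \<le> \<bar>s\<bar> ^ n" if "n \<ge> 0" for n
        using mult_left_mono [of 1 "real n + 1" "\<bar>s\<bar> ^ n"] by (simp add: power_abs divide_le_eq)
    qed
    have "ln (1 - s) = (\<Sum>n. (-1) ^ n * (1 / real (n + 1)) * (1 - s - 1) ^ Suc n)"
      using assms by (intro ln_series) auto
    also have "\<dots> = (\<Sum>n. - s * (s ^ n / (real n + 1)))"
    proof (intro suminf_cong)
      fix n
      have "(-1) ^ n * (- s) ^ Suc n = - s * s ^ n" by (induction n) auto
      then show "(-1) ^ n * (1 / real (n + 1)) * (1 - s - 1) ^ Suc n = - s * (s ^ n / (real n + 1))"
        by (simp add: field_simps)
    qed
    also have "\<dots> = - s * (\<Sum>n. s ^ n / (real n + 1))"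
      by (rule suminf_mult [OF summ])
    finally show ?thesis using False by (simp add: ln_quot_def)
  qed
  finally show ?thesis .
qed

text \<open>The terms are dominated on [0, 1] by those of the convergent series at 1, so convergence
  is uniform and the sum is continuous up to 1, where it takes Euler's value.\<close>

lemma dilog_series_tendsto:
  "((\<lambda>s. \<Sum>n. 1 / (real n)\<^sup>2 * s ^ n) \<longlongrightarrow> pi\<^sup>2 / 6) (at_left 1)"
proof -
  let ?S = "\<lambda>s. \<Sum>n. 1 / (real n)\<^sup>2 * s ^ n :: real"
  have summ: "summable (\<lambda>n. 1 / (real n)\<^sup>2)"
    using inverse_power_summable [of 2, where 'a = real] by (simp add: inverse_eq_divide)
  have "uniform_limit {0..1} (\<lambda>n s. \<Sum>i<n. 1 / (real i)\<^sup>2 * s ^ i) ?S sequentially"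
    by (rule Weierstrass_m_test [OF _ summ])
       (auto simp: abs_mult power_abs intro!: divide_right_mono power_le_one)
  then have "continuous_on {0..1} ?S"
    by (rule uniform_limit_theorem [rotated])
       (simp, intro always_eventually allI continuous_on_sum continuous_on_mult
        continuous_on_const continuous_on_power continuous_on_id)
  then have "(?S \<longlongrightarrow> ?S 1) (at 1 within {0..1})"
    unfolding continuous_on_def by (rule bspec) simp
  also have "at 1 within {0..1} = at_left (1::real)"
    by (simp add: at_within_Icc_at_left)
  also have "?S 1 = pi\<^sup>2 / 6"
  proof -
    have "(\<lambda>n. 1 / (real (Suc n))\<^sup>2) sums (pi\<^sup>2 / 6)"
      using inverse_squares_sums by (simp add: add_ac)
    then have "(\<lambda>n. 1 / (real n)\<^sup>2) sums (pi\<^sup>2 / 6)"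
      by (subst (asm) sums_Suc_iff) simp
    then show ?thesis by (simp add: sums_iff)
  qed
  finally show ?thesis .
qed

text \<open>Near 1 the function \<open>E\<close> is minus the dilogarithm of \<open>1 - x\<close>,
  which gives the limit at 0. The inversion formula gives access to the behaviour at
  infinity.\<close>

lemma ln_quot_antiderivative:
  obtains E where "\<And>x. x > 0 \<Longrightarrow> (E has_real_derivative ln_quot x) (at x)"
    and "E 1 = 0"
    and "(E \<longlongrightarrow> - (pi\<^sup>2 / 6)) (at_right 0)"
    and "\<And>x. x > 0 \<Longrightarrow> E x = (ln x)\<^sup>2 / 2 - E (1 / x)"
proof -
  have "\<exists>F. \<forall>x::real. 0 < ereal x \<longrightarrow> ereal x < \<infinity> \<longrightarrow> (F has_vector_derivative ln_quot x) (at x)"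
    by (rule einterval_antiderivative) (auto intro: isCont_ln_quot)
  then obtain F where F: "\<And>x::real. x > 0 \<Longrightarrow> (F has_real_derivative ln_quot x) (at x)"
    by (auto simp: has_real_derivative_iff_has_vector_derivative)
  define E where "E = (\<lambda>x. F x - F 1)"
  have E: "(E has_real_derivative ln_quot x) (at x)" if "x > 0" for x
    unfolding E_def by (auto intro!: derivative_eq_intros F that)
  have E1: "E 1 = 0" by (simp add: E_def)
  let ?S = "\<lambda>s. \<Sum>n. 1 / (real n)\<^sup>2 * s ^ n :: real"
  have eq: "E (1 - s) = - ?S s" if "s \<in> {-1<..<1}" for s
  proof -
    \<comment> \<open>The reflected \<open>E\<close> and the series have opposite derivatives; the
      constant is read off at \<open>s = 0\<close>, where both vanish.\<close>
    have "\<exists>c. \<forall>s\<in>{-1<..<1}. E (1 - s) + ?S s = c"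
    proof (rule has_field_derivative_zero_constant)
      fix s :: real assume s: "s \<in> {-1<..<1}"
      have "((\<lambda>s. E (1 - s)) has_real_derivative ln_quot (1 - s) * (- 1)) (at s)"
        by (rule DERIV_chain' [where f = "\<lambda>s. 1 - s"])
           (use s in \<open>auto intro!: E derivative_eq_intros\<close>)
      moreover have "(?S has_real_derivative ln_quot (1 - s)) (at s)"
        using s by (intro dilog_series_derivative) auto
      ultimately have "((\<lambda>s. E (1 - s) + ?S s) has_real_derivative
          ln_quot (1 - s) * (- 1) + ln_quot (1 - s)) (at s)" by (rule DERIV_add)
      then show "((\<lambda>s. E (1 - s) + ?S s) has_real_derivative 0) (at s within {-1<..<1})"
        by (auto intro: has_field_derivative_at_within)
    qed auto
    then obtain c where c: "\<And>s. s \<in> {-1<..<1} \<Longrightarrow> E (1 - s) + ?S s = c" by blast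
    have "?S 0 = 0" by (subst suminf_finite [of "{0}"]) auto
    with c [of 0] E1 have "c = 0" by simp
    with c [OF that] show ?thesis by simp
  qed
  have lim: "(E \<longlongrightarrow> - (pi\<^sup>2 / 6)) (at_right 0)"
  proof -
    have "filterlim (\<lambda>x::real. 1 - x) (at_left 1) (at_right 0)" by real_asymp
    with dilog_series_tendsto have "((\<lambda>x. ?S (1 - x)) \<longlongrightarrow> pi\<^sup>2 / 6) (at_right 0)"
      by (rule filterlim_compose)
    then have "((\<lambda>x. - ?S (1 - x)) \<longlongrightarrow> - (pi\<^sup>2 / 6)) (at_right 0)"
      by (rule tendsto_minus)
    then show ?thesis
    proof (rule Lim_transform_eventually)
      have "\<forall>\<^sub>F x in at_right 0. x \<in> {0<..<1::real}"
        by (rule eventually_at_right_real) simp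
      then show "\<forall>\<^sub>F x in at_right 0. - ?S (1 - x) = E x"
        by eventually_elim (use eq [of "1 - _"] in auto)
    qed
  qed
  have refl: "E x = (ln x)\<^sup>2 / 2 - E (1 / x)" if "x > 0" for x
  proof -
    \<comment> \<open>Since \<open>ln_quot (1 / x) = x * ln_quot x\<close>, the first two terms have
      derivative \<open>(x - 1) * ln_quot x / x = ln x / x\<close>, which the square of the
      logarithm cancels. The constant is found at \<open>x = 1\<close>.\<close>
    have "\<exists>c. \<forall>x\<in>{0<..}. E x + E (1 / x) - (ln x)\<^sup>2 / 2 = c"
    proof (rule has_field_derivative_zero_constant)
      fix x :: real assume x: "x \<in> {0<..}"
      have "((\<lambda>x. E (1 / x)) has_real_derivative ln_quot (1 / x) * (- 1 / x\<^sup>2)) (at x)"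
        by (rule DERIV_chain' [where f = "\<lambda>x. 1 / x"])
           (use x in \<open>auto intro!: E derivative_eq_intros simp: power2_eq_square\<close>)
      then have "((\<lambda>x. E x + E (1 / x) - (ln x)\<^sup>2 / 2) has_real_derivative
          (ln_quot x + ln_quot (1 / x) * (- 1 / x\<^sup>2)) - ln x / x) (at x)"
        using x by (auto intro!: derivative_eq_intros E)
      also have "(ln_quot x + ln_quot (1 / x) * (- 1 / x\<^sup>2)) - ln x / x = 0"
      proof (cases "x = 1")
        case False
        have "ln_quot (1 / x) = x * ln_quot x"
          using x False by (simp add: ln_quot_def ln_div divide_simps) (simp add: algebra_simps)
        then show ?thesis
          using x ln_quot_mult [of x] by (simp add: field_simps power2_eq_square)
      qed (simp add: ln_quot_def)
      finally show "((\<lambda>x. E x + E (1 / x) - (ln x)\<^sup>2 / 2) has_real_derivative 0)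
          (at x within {0<..})"
        by (auto intro: has_field_derivative_at_within)
    qed auto
    then obtain c where c: "\<And>x. x > 0 \<Longrightarrow> E x + E (1 / x) - (ln x)\<^sup>2 / 2 = c" by auto
    from c [of 1] E1 have "c = 0" by simp
    with c [OF that] show ?thesis by simp
  qed
  show thesis by (rule that [OF E E1 lim refl])
qed

section \<open>The dilogarithmic base integral\<close>

lemma has_newton_integral_ln_quot_base:
  assumes "a > 0"
  shows "has_newton_integral (\<lambda>x. ln_quot x / (x + a)) ((pi\<^sup>2 + (ln a)\<^sup>2) / 2 / (a + 1))"
proof -
  obtain E where E: "\<And>x. x > 0 \<Longrightarrow> (E has_real_derivative ln_quot x) (at x)"
    and E1: "E 1 = 0"
    and lim: "(E \<longlongrightarrow> - (pi\<^sup>2 / 6)) (at_right 0)"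
    and refl: "\<And>x. x > 0 \<Longrightarrow> E x = (ln x)\<^sup>2 / 2 - E (1 / x)"
    using ln_quot_antiderivative by metis
  define F where "F = (\<lambda>x. E x - ln x * ln (1 + x / a) + E (1 + x / a))"
  have "has_newton_integral (\<lambda>x. (a + 1) * (ln_quot x / (x + a)))
      ((pi\<^sup>2 / 6 + pi\<^sup>2 / 6 + (ln a)\<^sup>2 / 2) - (- (pi\<^sup>2 / 6) - 0 + 0))"
  proof (rule has_newton_integralI [where F = F])
    fix x :: real assume x: "x > 0"
    have pos: "1 + x / a > 0" using x assms by (simp add: add_pos_pos)
    have "((\<lambda>x. 1 + x / a) has_real_derivative 1 / a) (at x)"
      using assms by (auto intro!: derivative_eq_intros)
    from this E [OF pos]
    have "((\<lambda>x. E (1 + x / a)) has_real_derivative ln_quot (1 + x / a) * (1 / a)) (at x)"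
      by (rule DERIV_chain')
    then have "(F has_real_derivative ln_quot x - (1 / x * ln (1 + x / a) + ln x * (1 / a / (1 + x / a)))
        + ln_quot (1 + x / a) * (1 / a)) (at x)"
      unfolding F_def using x pos assms by (auto intro!: derivative_eq_intros E)
    \<comment> \<open>The derivative of \<open>E (1 + x / a)\<close> cancels the product rule term
      \<open>ln (1 + x / a) / x\<close>. What remains is
      \<open>((x + a) - (x - 1)) * ln_quot x / (x + a)\<close>, whence the factor
      \<open>a + 1\<close>.\<close>
    also have "ln_quot x - (1 / x * ln (1 + x / a) + ln x * (1 / a / (1 + x / a)))
        + ln_quot (1 + x / a) * (1 / a) = ln_quot x - ln x / (x + a)"
    proof -
      have "ln_quot (1 + x / a) * (1 / a) = ln (1 + x / a) / x"
        using x assms by (simp add: ln_quot_def)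
      moreover have "1 / a / (1 + x / a) = 1 / (x + a)"
        using x assms by (simp add: field_simps)
      ultimately show ?thesis by simp
    qed
    also have "\<dots> = (a + 1) * (ln_quot x / (x + a))"
      using x assms by (simp add: ln_quot_mult [symmetric] field_simps)
    finally show "(F has_real_derivative (a + 1) * (ln_quot x / (x + a))) (at x)" .
  next
    have "isCont E 1" using E [of 1] DERIV_isCont by force
    moreover have "((\<lambda>x. 1 + x / a) \<longlongrightarrow> 1) (at_right 0)"
      using assms by real_asymp
    ultimately have "((\<lambda>x. E (1 + x / a)) \<longlongrightarrow> 0) (at_right 0)"
      using isCont_tendsto_compose E1 by metis
    moreover have "((\<lambda>x. ln x * ln (1 + x / a)) \<longlongrightarrow> 0) (at_right 0)"
      using assms by real_asymp
    ultimately show "(F \<longlongrightarrow> - (pi\<^sup>2 / 6) - 0 + 0) (at_right 0)"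
      unfolding F_def by (intro tendsto_add tendsto_diff lim)
  next
    \<comment> \<open>Inversion moves both arguments of \<open>E\<close> from infinity to 0, so each
      contributes \<open>pi\<^sup>2 / 6\<close>. The two squares it produces and the product in
      \<open>F\<close> form the single square
      \<open>(ln x - ln (1 + x / a))\<^sup>2 / 2\<close>.\<close>
    have "filterlim (\<lambda>x::real. 1 / x) (at_right 0) at_top" by real_asymp
    with lim have "((\<lambda>x. E (1 / x)) \<longlongrightarrow> - (pi\<^sup>2 / 6)) at_top" by (rule filterlim_compose)
    moreover have "filterlim (\<lambda>x::real. 1 / (1 + x / a)) (at_right 0) at_top"
      using assms by real_asymp
    with lim have "((\<lambda>x. E (1 / (1 + x / a))) \<longlongrightarrow> - (pi\<^sup>2 / 6)) at_top"
      by (rule filterlim_compose)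
    moreover have "((\<lambda>x. (ln x - ln (1 + x / a))\<^sup>2 / 2) \<longlongrightarrow> (ln a)\<^sup>2 / 2) at_top"
    proof -
      have "((\<lambda>x. ln x - ln (1 + x / a)) \<longlongrightarrow> ln a) at_top"
        using assms by (real_asymp simp: ln_inverse)
      then show ?thesis by (intro tendsto_intros) auto
    qed
    ultimately have "((\<lambda>x. - E (1 / x) - E (1 / (1 + x / a)) + (ln x - ln (1 + x / a))\<^sup>2 / 2)
        \<longlongrightarrow> - (- (pi\<^sup>2 / 6)) - (- (pi\<^sup>2 / 6)) + (ln a)\<^sup>2 / 2) at_top"
      by (intro tendsto_add tendsto_diff tendsto_minus)
    then show "(F \<longlongrightarrow> pi\<^sup>2 / 6 + pi\<^sup>2 / 6 + (ln a)\<^sup>2 / 2) at_top"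
      unfolding minus_minus diff_minus_eq_add
    proof (rule Lim_transform_eventually)
      show "\<forall>\<^sub>F x in at_top. - E (1 / x) - E (1 / (1 + x / a)) + (ln x - ln (1 + x / a))\<^sup>2 / 2 = F x"
        using eventually_gt_at_top [of 0]
      proof eventually_elim
        case (elim x)
        have "1 + x / a > 0" using elim assms by (simp add: add_pos_pos)
        from refl [OF elim] refl [OF this] show ?case
          by (simp add: F_def power2_diff field_simps)
      qed
    qed
  qed simp
  from has_newton_integral_cmult [OF this, of "1 / (a + 1)"] show ?thesis
  proof (rule has_newton_integral_cong, goal_cases)
    case 1
    show ?case using assms by simp
  next
    case 2
    show ?case using assms by (simp add: field_simps)
  qed
qed

section \<open>Integrals with higher powers of x + a\<close>

lemma has_newton_integral_inverse_power:
  assumes "a > 0"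
  shows "has_newton_integral (\<lambda>x. 1 / (x + a) ^ (n + 2)) (1 / ((real n + 1) * a ^ (n + 1)))"
proof (rule has_newton_integralI)
  let ?F = "\<lambda>x. - 1 / ((real n + 1) * (x + a) ^ (n + 1))"
  have q: "real n + 1 > 0" by simp
  show "(?F has_real_derivative 1 / (x + a) ^ (n + 2)) (at x)" if "x > 0" for x
  proof -
    have nz: "x + a \<noteq> 0" using that assms by simp
    have "((\<lambda>x. (x + a) ^ Suc n) has_real_derivative (1 + real n) * (1 * (x + a) ^ n)) (at x)"
      by (rule DERIV_power_Suc) (auto intro!: derivative_eq_intros)
    then have "((\<lambda>x. inverse ((x + a) ^ Suc n)) has_real_derivative
        - (inverse ((x + a) ^ Suc n) * ((1 + real n) * (1 * (x + a) ^ n)) * inverse ((x + a) ^ Suc n))) (at x)"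
      by (rule DERIV_inverse') (use nz in simp)
    then have "((\<lambda>x. inverse ((x + a) ^ Suc n) / - (real n + 1)) has_real_derivative
        - (inverse ((x + a) ^ Suc n) * ((1 + real n) * (1 * (x + a) ^ n)) * inverse ((x + a) ^ Suc n)) / - (real n + 1)) (at x)"
      by (rule DERIV_cdivide)
    moreover have "inverse (y ^ Suc n) / - (real n + 1) = - 1 / ((real n + 1) * y ^ (n + 1))" for y :: real
      unfolding inverse_eq_divide divide_divide_eq_left Suc_eq_plus1
        mult_minus_right minus_divide_right [symmetric] minus_divide_left [symmetric]
      by (simp only: mult.commute)
    moreover have "- (inverse ((x + a) ^ Suc n) * ((1 + real n) * (1 * (x + a) ^ n)) * inverse ((x + a) ^ Suc n)) / - (real n + 1)
        = 1 / (x + a) ^ (n + 2)"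
    proof -
      have "- (inverse (y * z) * (q * (1 * z)) * inverse (y * z)) / - q = 1 / (z * y\<^sup>2)"
        if "y \<noteq> 0" "z \<noteq> 0" "q \<noteq> 0" for y z q :: real
        using that by (simp add: field_simps power2_eq_square)
      from this [of "x + a" "(x + a) ^ n" "real n + 1"] nz q show ?thesis
        by (simp add: add_ac power_add power2_eq_square)
    qed
    ultimately show ?thesis by (simp only:)
  qed
  show "(?F \<longlongrightarrow> - 1 / ((real n + 1) * (0 + a) ^ (n + 1))) (at_right 0)"
    using assms by (intro tendsto_intros) auto
  show "(?F \<longlongrightarrow> 0) at_top"
    using q assms by real_asymp
qed (use assms in auto)

text \<open>Integration by parts lowers the exponent by one; the term without logarithm contributes
  the next summand of the harmonic number.\<close>

lemma has_newton_integral_ln_div_power: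
  assumes "a > 0"
  shows "has_newton_integral (\<lambda>x. ln x / (x + a) ^ (n + 2))
    ((ln a - harm n) / ((real n + 1) * a ^ (n + 1)))"
proof (induction n)
  case 0
  \<comment> \<open>Integration by parts with \<open>x / (a * (x + a))\<close> as antiderivative of
    \<open>1 / (x + a)\<^sup>2\<close>: it vanishes at 0 and thereby absorbs the singularity of
    \<open>ln\<close>.\<close>
  let ?F = "\<lambda>x. (x * ln x / (x + a) - ln (x + a)) / a"
  have "has_newton_integral (\<lambda>x. ln x / (x + a)\<^sup>2) (ln a / a)"
  proof (rule has_newton_integralI)
    show "(?F has_real_derivative ln x / (x + a)\<^sup>2) (at x)" if "x > 0" for x
    proof -
      have "(?F has_real_derivative
          (((ln x + 1) * (x + a) - x * ln x) / ((x + a) * (x + a)) - 1 / (x + a)) / a) (at x)"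
        using that assms by (auto intro!: derivative_eq_intros)
      also have "(((ln x + 1) * (x + a) - x * ln x) / ((x + a) * (x + a)) - 1 / (x + a)) / a
          = ln x / (x + a)\<^sup>2"
        using that assms by (simp add: divide_simps power2_eq_square) (simp add: algebra_simps)
      finally show ?thesis .
    qed
    show "(?F \<longlongrightarrow> - ln a / a) (at_right 0)"
      using assms by (real_asymp simp: divide_inverse)
    show "(?F \<longlongrightarrow> 0) at_top" using assms by real_asymp
  qed auto
  then show ?case by (simp add: harm_def power2_eq_square)
next
  case (Suc n)
  let ?F = "\<lambda>x. x * ln x / (x + a) ^ (n + 2)"
  have "has_newton_integral (\<lambda>x. ln x / (x + a) ^ (n + 2) + 1 / (x + a) ^ (n + 2)
      - (real n + 2) * x * ln x / (x + a) ^ (n + 3)) 0"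
  proof (rule has_newton_integralI [where F = ?F])
    show "(?F has_real_derivative ln x / (x + a) ^ (n + 2) + 1 / (x + a) ^ (n + 2)
      - (real n + 2) * x * ln x / (x + a) ^ (n + 3)) (at x)" if "x > 0" for x
    proof -
      have nz: "x + a \<noteq> 0" using that assms by simp
      have "((\<lambda>x. (x + a) ^ Suc (n + 1)) has_real_derivative
          (1 + real (n + 1)) * (1 * (x + a) ^ (n + 1))) (at x)"
        by (rule DERIV_power_Suc) (auto intro!: derivative_eq_intros)
      moreover have "((\<lambda>x. x * ln x) has_real_derivative ln x + 1) (at x)"
        using that by (auto intro!: derivative_eq_intros)
      ultimately have "((\<lambda>x. x * ln x / (x + a) ^ Suc (n + 1)) has_real_derivative
          ((ln x + 1) * (x + a) ^ Suc (n + 1) - x * ln x * ((1 + real (n + 1)) * (1 * (x + a) ^ (n + 1))))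
          / ((x + a) ^ Suc (n + 1) * (x + a) ^ Suc (n + 1))) (at x)"
        using nz by (intro DERIV_divide) auto
      moreover have "((l + 1) * (z * y * y) - x * l * ((1 + q) * (1 * (z * y)))) / ((z * y * y) * (z * y * y))
          = l / (z * y * y) + 1 / (z * y * y) - (1 + q) * x * l / (z * y * y * y)"
        if "y \<noteq> 0" "z \<noteq> 0" for l y z q :: real
        using that by (simp add: divide_simps) (simp add: algebra_simps)
      from this [of "x + a" "(x + a) ^ n" "ln x" "real n + 1"] nz
      have "((ln x + 1) * (x + a) ^ Suc (n + 1) - x * ln x * ((1 + real (n + 1)) * (1 * (x + a) ^ (n + 1))))
          / ((x + a) ^ Suc (n + 1) * (x + a) ^ Suc (n + 1)) =
          ln x / (x + a) ^ (n + 2) + 1 / (x + a) ^ (n + 2)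
          - (real n + 2) * x * ln x / (x + a) ^ (n + 3)"
        by (simp add: mult_ac add_ac numeral_2_eq_2 numeral_3_eq_3)
      ultimately show ?thesis by simp
    qed
    show "(?F \<longlongrightarrow> 0) (at_right 0)"
    proof -
      have "((\<lambda>x::real. x * ln x) \<longlongrightarrow> 0) (at_right 0)" by real_asymp
      moreover have "((\<lambda>x. (x + a) ^ (n + 2)) \<longlongrightarrow> (0 + a) ^ (n + 2)) (at_right 0)"
        by (intro tendsto_intros)
      ultimately have "(?F \<longlongrightarrow> 0 / (0 + a) ^ (n + 2)) (at_right 0)"
        using assms by (intro tendsto_divide) auto
      then show ?thesis by simp
    qed
    show "(?F \<longlongrightarrow> 0) at_top" using assms by real_asymp
  qed simp
  \<comment> \<open>Writing \<open>x = (x + a) - a\<close> in the last term and solving for the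
    integral with exponent \<open>n + 3\<close> gives these three coefficients.\<close>
  from has_newton_integral_add [OF has_newton_integral_add [OF
      has_newton_integral_cmult [OF this, of "1 / ((real n + 2) * a)"]
      has_newton_integral_cmult [OF Suc.IH, of "(real n + 1) / ((real n + 2) * a)"]]
      has_newton_integral_cmult [OF has_newton_integral_inverse_power [OF assms, of n], of "- 1 / ((real n + 2) * a)"]]
  show ?case
  proof (rule has_newton_integral_cong, goal_cases)
    case (1 x)
    define q where "q = real n + 2"
    have q: "real n = q - 2" "q > 0" by (auto simp: q_def)
    have [simp]: "x + a \<noteq> 0" using assms 1 by simp
    show ?case unfolding q power_add using q(2) assms
      by (simp add: divide_simps power2_eq_square power3_eq_cube) (simp add: algebra_simps)
  next
    case 2
    show ?case using assms by (simp add: harm_Suc divide_simps) (simp add: algebra_simps)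
  qed
qed

text \<open>This is \<open>(a + 1) ^ (j + 1)\<close> times the integral of
  \<open>ln x / (x + a) ^ (j + 2)\<close>; with this scaling the partial fraction recursion becomes
  a plain sum.\<close>

definition log_term :: "real \<Rightarrow> nat \<Rightarrow> real" where
  "log_term a j = (1 + 1 / a) ^ (j + 1) / (real j + 1) * (ln a - harm j)"

lemma has_newton_integral_ln_log_term:
  assumes "a > 0"
  shows "has_newton_integral (\<lambda>x. ln x / (x + a) ^ (n + 2)) (log_term a n / (a + 1) ^ (n + 1))"
proof -
  have "1 + 1 / a = (a + 1) / a" using assms by (simp add: field_simps)
  then have "log_term a n / (a + 1) ^ (n + 1) = (ln a - harm n) / ((real n + 1) * a ^ (n + 1))"
    using assms unfolding log_term_def by (simp add: power_divide)
  then show ?thesis using has_newton_integral_ln_div_power [OF assms, of n] by simp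
qed

text \<open>From \<open>(x + a) - (x - 1) = a + 1\<close>, each further factor \<open>x + a\<close>
  costs a division by \<open>a + 1\<close> and the subtraction of one logarithmic integral.\<close>

lemma has_newton_integral_ln_quot_div_power:
  assumes "a > 0"
  shows "has_newton_integral (\<lambda>x. ln_quot x / (x + a) ^ (n + 1))
    (((pi\<^sup>2 + (ln a)\<^sup>2) / 2 - (\<Sum>j<n. log_term a j)) / (a + 1) ^ (n + 1))"
proof (induction n)
  case 0
  show ?case using has_newton_integral_ln_quot_base [OF assms] by simp
next
  case (Suc n)
  from has_newton_integral_add [OF has_newton_integral_cmult [OF Suc.IH, of "1 / (a + 1)"]
      has_newton_integral_cmult [OF has_newton_integral_ln_log_term [OF assms, of n], of "- 1 / (a + 1)"]]
  show ?case
  proof (rule has_newton_integral_cong, goal_cases)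
    case (1 x)
    have "x + a \<noteq> 0" "a + 1 \<noteq> 0" using 1 assms by auto
    then show ?case
      by (simp add: ln_quot_mult [OF 1, symmetric] divide_simps) (simp add: algebra_simps)
  next
    case 2
    have "a + 1 \<noteq> 0" using assms by simp
    then show ?case by (simp add: divide_simps)
  qed
qed

section \<open>Finite sums and the closed form\<close>

text \<open>The weight cancels the denominator of \<open>log_term\<close>. With
  \<open>r = 1 + 1 / a\<close>, the power \<open>r ^ (j + 1)\<close> is the forward difference of
  \<open>a * r ^ (j + 1)\<close>, and summation by parts moves the difference onto
  \<open>harm\<close>. Induction verifies the outcome.\<close>

lemma sum_log_term_weight1:
  assumes "a > 0"
  shows "(\<Sum>j<k. (real j + 1) * log_term a j) =
    a * ((1 + 1 / a) ^ (k + 1) * (ln a - harm k) - (1 + 1 / a) * ln a)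
    + (a + 1) * (\<Sum>j<k. (1 + 1 / a) ^ (j + 1) / (real j + 1))"
proof (induction k)
  case 0
  show ?case by (simp add: harm_def)
next
  case (Suc k)
  have h: "harm (Suc k) = harm k + 1 / (real k + 1 :: real)"
    by (simp add: harm_Suc field_simps)
  define X where "X = (1 + 1 / a) ^ k"
  define A where "A = (\<Sum>j<k. (1 + 1 / a) ^ (j + 1) / (real j + 1))"
  define q where "q = real k + 1"
  have q: "real k = q - 1" "q \<noteq> 0" by (auto simp: q_def)
  have X: "(1 + 1 / a) ^ (k + 1) = X * (1 + 1 / a)" "(1 + 1 / a) ^ (Suc k + 1) = X * (1 + 1 / a)\<^sup>2"
    "(1 + 1 / a) ^ Suc k = X * (1 + 1 / a)"
    by (simp_all add: X_def power2_eq_square)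
  have t: "log_term a k = X * (1 + 1 / a) / (real k + 1) * (ln a - harm k)"
    by (simp add: log_term_def X_def)
  show ?case
    unfolding sum.lessThan_Suc Suc.IH t h X A_def [symmetric] X_def [symmetric] of_nat_Suc
    unfolding q using q(2) assms
    by (simp add: divide_simps) (simp add: algebra_simps power2_eq_square)
qed

text \<open>Summation by parts again: for \<open>r = 1 + 1 / a\<close>, the sequence
  \<open>r ^ (j + 1) * (a * j - a\<^sup>2)\<close> has forward difference
  \<open>(j + 1) * r ^ (j + 1)\<close>. The last summand is the geometric sum that arises.\<close>

lemma sum_log_term_weight2:
  assumes "a > 0"
  shows "(\<Sum>j<k. (real j + 1)\<^sup>2 * log_term a j) =
    (1 + 1 / a) ^ (k + 1) * (ln a - harm k) * (a * real k - a\<^sup>2) + (1 + 1 / a) * ln a * a\<^sup>2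
    - a * (a + 1) * (\<Sum>j<k. (1 + 1 / a) ^ (j + 1) / (real j + 1))
    + (a + 1)\<^sup>2 * ((1 + 1 / a) ^ k - 1)"
proof (induction k)
  case 0
  show ?case by (simp add: harm_def)
next
  case (Suc k)
  have h: "harm (Suc k) = harm k + 1 / (real k + 1 :: real)"
    by (simp add: harm_Suc field_simps)
  define X where "X = (1 + 1 / a) ^ k"
  define A where "A = (\<Sum>j<k. (1 + 1 / a) ^ (j + 1) / (real j + 1))"
  define q where "q = real k + 1"
  have q: "real k = q - 1" "q \<noteq> 0" by (auto simp: q_def)
  have X: "(1 + 1 / a) ^ (k + 1) = X * (1 + 1 / a)" "(1 + 1 / a) ^ (Suc k + 1) = X * (1 + 1 / a)\<^sup>2"
    "(1 + 1 / a) ^ Suc k = X * (1 + 1 / a)"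
    by (simp_all add: X_def power2_eq_square)
  have t: "log_term a k = X * (1 + 1 / a) / (real k + 1) * (ln a - harm k)"
    by (simp add: log_term_def X_def)
  show ?case
    unfolding sum.lessThan_Suc Suc.IH t h X A_def [symmetric] X_def [symmetric] of_nat_Suc
    unfolding q using q(2) assms
    by (simp add: divide_simps) (simp add: algebra_simps power2_eq_square)
qed

lemma sum_geometric_ratio:
  assumes "a > (0::real)"
  shows "(\<Sum>j<k. (1 + 1 / a) ^ (j + 1)) = (a + 1) * ((1 + 1 / a) ^ k - 1)"
proof (induction k)
  case (Suc k)
  have "(1 + 1 / a) ^ (k + 1) = (1 + 1 / a) ^ k * (1 + 1 / a)"
    "(1 + 1 / a) ^ Suc k = (1 + 1 / a) ^ k * (1 + 1 / a)" by simp_all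
  then show ?case
    unfolding sum.lessThan_Suc Suc.IH using assms by (simp only:) (simp add: field_simps)
qed simp

text \<open>The left side is the value delivered by the three integrals of the decomposition, the
  right side the stated one.\<close>

lemma closed_form_eq:
  assumes "a > 0"
  shows "((pi\<^sup>2 + (ln a)\<^sup>2) / 2 - (\<Sum>j<k + 2. log_term a j)) / (a + 1) ^ (k + 3)
      + log_term a k / (a + 1) ^ (k + 1)
      + (1 - a) * (log_term a (k + 1) / (a + 1) ^ (k + 2))
    = (pi\<^sup>2 + (ln a)\<^sup>2) / (2 * (a + 1) ^ (k + 3))
      + 1 / ((real k + 1) * (real k + 2) * (a + 1) ^ (k + 1))
        * ((a + 3 + 2 * real k) / (a + 1) * ln a + 1
           + 1 / a * (\<Sum>j<k. (1 + 1 / a) ^ j / (real j + 1)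
               * ((real k - real j) * (real k + 1 - real j) / (a + 1) * (harm j - ln a)
                  - a - 1 - 2 * (real k - real j))))"
proof -
  define r where "r = 1 + 1 / a"
  define A where "A = (\<Sum>j<k. r ^ (j + 1) / (real j + 1))"
  define S where "S = (\<Sum>j<k. log_term a j)"
  define X where "X = r ^ k"
  define h where "h = (harm k :: real)"
  have ar: "a * r = a + 1" using assms by (simp add: r_def field_simps)
  have nz: "a \<noteq> 0" "a + 1 \<noteq> 0" "real k + 1 \<noteq> 0" "real k + 2 \<noteq> 0" using assms by auto
  \<comment> \<open>Here \<open>(k - j) * (k + 1 - j) = (k + 1) * (k + 2) - (2 * k + 3) * (j + 1) +
    (j + 1)\<^sup>2\<close> and
    \<open>- a - 1 - 2 * (k - j) = - (a + 3 + 2 * k) + 2 * (j + 1)\<close>, while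
    \<open>r ^ j / a = r ^ (j + 1) / (a + 1)\<close>.\<close>
  have "1 / a * (\<Sum>j<k. r ^ j / (real j + 1)
               * ((real k - real j) * (real k + 1 - real j) / (a + 1) * (harm j - ln a)
                  - a - 1 - 2 * (real k - real j)))
      = (\<Sum>j<k. - ((real k + 1) * (real k + 2) / (a + 1)\<^sup>2) * log_term a j
          + (2 * real k + 3) / (a + 1)\<^sup>2 * ((real j + 1) * log_term a j)
          - 1 / (a + 1)\<^sup>2 * ((real j + 1)\<^sup>2 * log_term a j)
          - (a + 3 + 2 * real k) / (a + 1) * (r ^ (j + 1) / (real j + 1))
          + 2 / (a + 1) * r ^ (j + 1))"
    unfolding sum_distrib_left
  proof (rule sum.cong, goal_cases)
    case (2 j)
    define d where "d = real j + 1"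
    have d: "real j = d - 1" "d \<noteq> 0" by (auto simp: d_def)
    have rr: "r ^ (j + 1) = r ^ j * (a + 1) / a" using nz by (simp add: r_def field_simps)
    show ?case
      unfolding log_term_def r_def [symmetric] rr
      unfolding d using nz d(2)
      by (simp add: divide_simps) (simp add: algebra_simps power2_eq_square)
  qed auto
  also have "\<dots> = - ((real k + 1) * (real k + 2) / (a + 1)\<^sup>2) * S
          + (2 * real k + 3) / (a + 1)\<^sup>2 * (\<Sum>j<k. (real j + 1) * log_term a j)
          - 1 / (a + 1)\<^sup>2 * (\<Sum>j<k. (real j + 1)\<^sup>2 * log_term a j)
          - (a + 3 + 2 * real k) / (a + 1) * A
          + 2 / (a + 1) * (\<Sum>j<k. r ^ (j + 1))"
    unfolding sum.distrib sum_subtractf sum_distrib_left [symmetric] A_def S_def ..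
  finally have sum_eq: "1 / a * (\<Sum>j<k. r ^ j / (real j + 1)
               * ((real k - real j) * (real k + 1 - real j) / (a + 1) * (harm j - ln a)
                  - a - 1 - 2 * (real k - real j))) = \<dots>" .
  have Mk: "log_term a k = X * ((a + 1) / a) / (real k + 1) * (ln a - h)"
    using nz by (simp add: log_term_def X_def r_def h_def field_simps)
  have Mk1: "log_term a (k + 1) =
      X * ((a + 1) / a)\<^sup>2 / (real k + 2) * (ln a - h - 1 / (real k + 1))"
  proof -
    have "1 + 1 / a = (a + 1) / a" using nz by (simp add: field_simps)
    moreover have "harm (k + 1) = h + 1 / (real k + 1)"
      by (simp add: harm_Suc h_def field_simps)
    ultimately show ?thesis
      by (simp add: log_term_def X_def r_def power2_eq_square add_ac diff_diff_eq)
  qed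
  have P1: "(\<Sum>j<k. (real j + 1) * log_term a j) = (a + 1) * (X * (ln a - h) - ln a + A)"
  proof -
    have "(\<Sum>j<k. (real j + 1) * log_term a j) = (a * r) * (X * (ln a - h) - ln a) + (a + 1) * A"
      unfolding sum_log_term_weight1 [OF assms] r_def [symmetric] A_def [symmetric]
      by (simp add: X_def h_def algebra_simps)
    then show ?thesis unfolding ar by (simp add: algebra_simps)
  qed
  have P2: "(\<Sum>j<k. (real j + 1)\<^sup>2 * log_term a j) =
     (a + 1) * (X * (ln a - h) * (real k - a) + a * ln a - a * A + (a + 1) * (X - 1))"
  proof -
    have "(\<Sum>j<k. (real j + 1)\<^sup>2 * log_term a j) =
        (a * r) * (X * (ln a - h) * (real k - a) + a * ln a) - a * (a + 1) * A
        + (a + 1)\<^sup>2 * (X - 1)"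
      unfolding sum_log_term_weight2 [OF assms] r_def [symmetric] A_def [symmetric]
      by (simp add: X_def h_def algebra_simps power2_eq_square)
    then show ?thesis unfolding ar by (simp add: algebra_simps power2_eq_square)
  qed
  have P0: "(\<Sum>j<k. r ^ (j + 1)) = (a + 1) * (X - 1)"
    unfolding r_def X_def sum_geometric_ratio [OF assms] ..
  \<comment> \<open>The two top terms are split off, to be merged with the separate logarithmic
    integrals; the rest matches the sum of weight zero.\<close>
  have S2: "(\<Sum>j<k + 2. log_term a j) = S + log_term a k + log_term a (k + 1)"
    by (simp add: S_def numeral_2_eq_2)
  \<comment> \<open>With powers, sums and denominators named, the goal becomes a rational identity
    in which the contributions of \<open>A\<close> cancel.\<close>
  define Y where "Y = (a + 1) ^ k"
  have Y: "Y \<noteq> 0" using nz by (simp add: Y_def)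
  have pw: "(a + 1) ^ (k + 3) = Y * (a + 1) ^ 3" "(a + 1) ^ (k + 1) = Y * (a + 1)"
    "(a + 1) ^ (k + 2) = Y * (a + 1)\<^sup>2" by (simp_all add: Y_def power_add power2_eq_square)
  define q where "q = real k + 1"
  have q: "real k = q - 1" "q \<noteq> 0" "q + 1 \<noteq> 0" by (auto simp: q_def)
  define c where "c = a + 1"
  have c: "c \<noteq> 0" using nz by (simp add: c_def)
  show ?thesis
    unfolding r_def [symmetric] sum_eq P0 P1 P2 S2 Mk Mk1 pw
    unfolding q c_def [symmetric]
    using nz(1) Y q(2,3) c
    by (simp add: divide_simps) (simp add: c_def algebra_simps power2_eq_square power3_eq_cube)
qed
theorem theorem9:
  fixes k :: nat and a :: real
  assumes "a > 0"
  shows "((\<lambda>x::real. x\<^sup>2 * ln x / ((x - 1) * (x + a) ^ (k + 3))) has_integral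
     ((pi\<^sup>2 + (ln a)\<^sup>2) / (2 * (a + 1) ^ (k + 3))
      + 1 / ((real k + 1) * (real k + 2) * (a + 1) ^ (k + 1))
        * ((a + 3 + 2 * real k) / (a + 1) * ln a + 1
           + 1 / a * (\<Sum>j<k. (1 + 1 / a) ^ j / (real j + 1)
               * ((real k - real j) * (real k + 1 - real j) / (a + 1) * (harm j - ln a)
                  - a - 1 - 2 * (real k - real j)))))) {0<..}"
proof -
  \<comment> \<open>The continuous version of the integrand, needed because continuity is required
    at every positive point, including 1.\<close>
  let ?g = "\<lambda>x. x\<^sup>2 * ln_quot x / (x + a) ^ (k + 3)"
  let ?v = "((pi\<^sup>2 + (ln a)\<^sup>2) / 2 - (\<Sum>j<k + 2. log_term a j)) / (a + 1) ^ (k + 3)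
      + log_term a k / (a + 1) ^ (k + 1)
      + (1 - a) * (log_term a (k + 1) / (a + 1) ^ (k + 2))"
  \<comment> \<open>In \<open>x\<^sup>2 / (x - 1) = 1 / (x - 1) + x + 1\<close> the polynomial part
    is rewritten as \<open>(x + a) + (1 - a)\<close>, which yields the last two integrals.\<close>
  have "has_newton_integral (\<lambda>x. ln_quot x / (x + a) ^ (k + 2 + 1) + ln x / (x + a) ^ (k + 2)
      + (1 - a) * (ln x / (x + a) ^ (k + 1 + 2)))
      (((pi\<^sup>2 + (ln a)\<^sup>2) / 2 - (\<Sum>j<k + 2. log_term a j)) / (a + 1) ^ (k + 2 + 1)
      + log_term a k / (a + 1) ^ (k + 1)
      + (1 - a) * (log_term a (k + 1) / (a + 1) ^ (k + 1 + 1)))"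
    by (intro has_newton_integral_add has_newton_integral_cmult
        has_newton_integral_ln_quot_div_power has_newton_integral_ln_log_term assms)
  then have "has_newton_integral ?g ?v"
  proof (rule has_newton_integral_cong, goal_cases)
    case (1 x)
    define z where "z = (x + a) ^ (k + 2)"
    have z: "z \<noteq> 0" "x + a \<noteq> 0" using 1 assms by (auto simp: z_def)
    have pw: "(x + a) ^ (k + 2 + 1) = z * (x + a)" "(x + a) ^ (k + 1 + 2) = z * (x + a)"
      "(x + a) ^ (k + 3) = z * (x + a)"
      by (simp_all add: z_def numeral_2_eq_2 numeral_3_eq_3)
    show ?case
      unfolding pw z_def [symmetric] ln_quot_mult [OF 1, symmetric] using z
      by (simp add: divide_simps) (simp add: algebra_simps power2_eq_square)
  qed (simp add: numeral_2_eq_2 numeral_3_eq_3)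
  then have "(?g has_integral ?v) {0<..}"
  proof (rule has_integral_if_has_newton_integral)
    fix x :: real assume x: "x > 0"
    show "isCont ?g x" using x assms by (intro continuous_intros isCont_ln_quot) auto
    show "?g x \<ge> 0" using x assms ln_quot_nonneg [OF x] by simp
  qed
  then show ?thesis
    unfolding closed_form_eq [OF assms]
    \<comment> \<open>At \<open>x = 1\<close> the stated integrand is 0 by division by zero, unlike
      \<open>?g\<close>; a single point does not affect the integral.\<close>
    by (rule has_integral_spike_finite [of "{1}", rotated 2]) (auto simp: ln_quot_def)
qed

end
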